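(* Let $\gamma=(1+\sqrt5)/2$ and let $\xi\in\mathbb{C}$. Assume that for every sufficiently large positive real number $X$ there exists a non-zero polynomial $P\in\mathbb{Z}[T]$ with $\deg(P)\le 2$ and $H(P)\le X$ such that $$|P(\xi)|\le \frac14 X^{-\gamma^2}.$$ Then $\xi$ is algebraic over $\mathbb{Q}$ of degree at most $2$.
   Context: The height $H(P)$ of a polynomial $P$ is the largest absolute value of its coefficients. *)

theory Defs
  imports Complex_Main "HOL-Computational_Algebra.Polynomial"
begin

text \<open>The height is 0 for the zero polynomial.\<close>

definition poly_height :: "int poly \<Rightarrow> int" where
  "poly_height P = Max ((\<lambda>i. \<bar>coeff P i\<bar>) ` {..degree P})"

text \<open>
  The degree of a number that is algebraic over the rationals is the degree of its minimal
  polynomial. The description below is unspecified for transcendental arguments; lemma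
  \<open>min_poly_rat_unique_exists\<close> shows that it is proper for algebraic ones.
\<close>

definition min_poly_rat :: "complex \<Rightarrow> rat poly" where
  "min_poly_rat x =
     (THE p. lead_coeff p = 1 \<and> irreducible p \<and> poly (map_poly of_rat p) x = 0)"

definition algebraic_degree :: "complex \<Rightarrow> nat" where
  "algebraic_degree x = degree (min_poly_rat x)"

lemma poly_of_rat_mult:
  "poly (map_poly of_rat (p * q)) (x :: complex) =
     poly (map_poly of_rat p) x * poly (map_poly of_rat q) x"
proof -
  have "map_poly (of_rat :: rat \<Rightarrow> complex) (p * q) = map_poly of_rat p * map_poly of_rat q"
    by (rule poly_eqI) (simp add: coeff_map_poly coeff_mult of_rat_sum of_rat_mult)
  thus ?thesis by simp
qed

lemma poly_of_rat_add:
  "poly (map_poly of_rat (p + q)) (x :: complex) =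
     poly (map_poly of_rat p) x + poly (map_poly of_rat q) x"
proof -
  have "map_poly (of_rat :: rat \<Rightarrow> complex) (p + q) = map_poly of_rat p + map_poly of_rat q"
    by (rule poly_eqI) (simp add: coeff_map_poly of_rat_add)
  thus ?thesis by simp
qed

lemma algebraic_imp_rat_poly:
  assumes "algebraic (x :: complex)"
  obtains p :: "rat poly" where "p \<noteq> 0" "poly (map_poly of_rat p) x = 0"
proof -
  obtain q where q: "\<And>i. coeff q i \<in> \<int>" "q \<noteq> 0" "poly q x = 0"
    using assms unfolding algebraic_def by blast
  define f :: "complex \<Rightarrow> rat" where "f c = (SOME r. of_rat r = c)" for c
  have f: "of_rat (f c) = c" if "c \<in> \<int>" for c
  proof -
    have "\<exists>r. of_rat r = c" using that by (metis Ints_cases of_rat_of_int_eq)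
    thus ?thesis unfolding f_def by (rule someI_ex)
  qed
  have f0: "f 0 = 0" using f[of 0] by simp
  have eq: "map_poly of_rat (map_poly f q) = q"
    by (rule poly_eqI) (simp add: coeff_map_poly f0 f q(1))
  show ?thesis
    by (rule that[of "map_poly f q"]) (use eq q in auto)
qed

lemma min_poly_rat_unique_exists:
  assumes "algebraic (x :: complex)"
  shows "\<exists>!p. lead_coeff p = 1 \<and> irreducible p \<and> poly (map_poly of_rat p) x = 0"
proof -
  define R where "R p \<longleftrightarrow> poly (map_poly of_rat p) x = 0" for p :: "rat poly"
  have R_mult: "R (p * q) \<longleftrightarrow> R p \<or> R q" for p q
    by (simp add: R_def poly_of_rat_mult)
  have not_R_const: "\<not> R [:c:]" if "c \<noteq> 0" for c
    using that by (simp add: R_def map_poly_pCons)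
  have ex: "\<exists>p. p \<noteq> 0 \<and> R p"
    using assms by (auto simp: R_def elim: algebraic_imp_rat_poly)
  define d where "d = (LEAST d. \<exists>p. p \<noteq> 0 \<and> R p \<and> degree p = d)"
  have "\<exists>p. p \<noteq> 0 \<and> R p \<and> degree p = d"
    unfolding d_def by (rule LeastI_ex) (use ex in auto)
  then obtain m0 where m0: "m0 \<noteq> 0" "R m0" "degree m0 = d" by blast
  have d_le: "d \<le> degree p" if "p \<noteq> 0" "R p" for p
    unfolding d_def by (rule Least_le) (use that in auto)
  define m where "m = smult (inverse (lead_coeff m0)) m0"
  have m: "m \<noteq> 0" "degree m = d" "lead_coeff m = 1" using m0 by (auto simp: m_def)
  have Rm: "R m"
    using m0 R_mult[of "[:inverse (lead_coeff m0):]" m0] by (simp add: m_def)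
  have d_pos: "d > 0"
  proof (rule ccontr)
    assume "\<not> d > 0"
    then obtain c where "m = [:c:]" using m(2) degree_eq_zeroE by blast
    thus False using not_R_const[of c] Rm m(1) by auto
  qed
  have m_not_unit: "\<not> m dvd 1"
    using m d_pos by (simp add: is_unit_iff_degree)
  have irr: "irreducible m"
  proof (rule irreducibleI[OF m(1) m_not_unit])
    fix a b assume ab: "m = a * b"
    hence nz: "a \<noteq> 0" "b \<noteq> 0" using m(1) by auto
    have deg: "d = degree a + degree b" using m(2) nz by (simp add: ab degree_mult_eq)
    have "R a \<or> R b" using Rm ab R_mult by simp
    hence "degree b = 0 \<or> degree a = 0" using d_le[of a] d_le[of b] nz deg by auto
    thus "a dvd 1 \<or> b dvd 1" using nz by (auto simp: is_unit_iff_degree)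
  qed
  have m_dvd: "m dvd q" if "R q" for q
  proof (rule ccontr)
    assume "\<not> m dvd q"
    hence nz: "q mod m \<noteq> 0" by (simp add: mod_eq_0_iff_dvd)
    have "R (q mod m)"
    proof -
      have "poly (map_poly of_rat (q div m * m + q mod m)) x = 0"
        using that by (simp add: R_def)
      thus ?thesis using Rm by (simp only: R_def poly_of_rat_add poly_of_rat_mult) simp
    qed
    hence "d \<le> degree (q mod m)" using d_le nz by blast
    moreover have "degree (q mod m) < d" using degree_mod_less[OF m(1), of q] nz m(2) by auto
    ultimately show False by simp
  qed
  show ?thesis
  proof (rule ex1I[of _ m])
    show "lead_coeff m = 1 \<and> irreducible m \<and> poly (map_poly of_rat m) x = 0"
      using m irr Rm by (simp add: R_def)
  next
    fix q :: "rat poly"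
    assume q: "lead_coeff q = 1 \<and> irreducible q \<and> poly (map_poly of_rat q) x = 0"
    then obtain r where r: "q = m * r" using m_dvd[of q] by (auto simp: R_def elim: dvdE)
    have "r dvd 1" using irreducibleD[of q m r] q r m_not_unit by auto
    then obtain c where c: "r = [:c:]" by (auto simp: is_unit_poly_iff)
    have "c = 1" using q m(3) unfolding r lead_coeff_mult by (simp add: c)
    thus "q = m" using r c by simp
  qed
qed

end

theory Submission
  imports Defs
begin

text \<open>
  Suppose that no non-zero integral polynomial of degree at most 2 vanishes at \<open>\<xi>\<close>. Replacing
  \<open>\<xi>\<close> by \<open>1/\<xi>\<close> and every polynomial by its reciprocal, one may assume \<open>\<bar>\<xi>\<bar> \<le> 1\<close>. As in the method
  of Davenport and Schmidt, take polynomials \<open>P\<^sub>0, P\<^sub>1, \<dots>\<close> of strictly decreasing absolute value at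
  \<open>\<xi>\<close>, each of the smallest height that improves on its predecessor. Write \<open>X\<^sub>n\<close> for the height of
  \<open>P\<^sub>n\<close>. The hypothesis, applied just below \<open>X\<^sub>n\<^sub>+\<^sub>1\<close>, bounds \<open>\<bar>P\<^sub>n(\<xi>)\<bar>\<close> by \<open>X\<^sub>n\<^sub>+\<^sub>1\<close> to the power
  \<open>-\<gamma>\<^sup>2\<close>, divided by 4.

  Two integers are played against each other at every step. If the determinant of the coefficients of
  \<open>P\<^sub>n, P\<^sub>n\<^sub>+\<^sub>1, P\<^sub>n\<^sub>+\<^sub>2\<close> is not 0, its absolute value is at least 1, and this forces \<open>X\<^sub>n\<^sub>+\<^sub>2\<close> to be at
  least about \<open>2\<close> times the \<open>\<gamma>\<close>-th power of \<open>X\<^sub>n\<^sub>+\<^sub>1\<close> (lemma \<open>determinant_bound\<close>). If the resultant of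
  \<open>P\<^sub>n\<^sub>+\<^sub>1\<close> and \<open>P\<^sub>n\<^sub>+\<^sub>2\<close> is not 0, then \<open>X\<^sub>n\<^sub>+\<^sub>2\<close> is at most about \<open>(3/2)\<close> to the power \<open>\<gamma>\<close> times
  the same quantity (lemma \<open>resultant_bound\<close>); here the factor 3 bounds a derivative at \<open>\<xi>\<close> in terms
  of the height and is the reason for \<open>\<bar>\<xi>\<bar> \<le> 1\<close>. Since \<open>(3/2)\<close> to the power \<open>\<gamma>\<close> is about 1.93, which is
  less than 2, the two cannot both be non-zero when \<open>n\<close> is large. This is where the constant 1/4 matters.

  It remains to find a large \<open>n\<close> at which both are non-zero. The determinants are non-zero infinitely
  often, as otherwise \<open>\<xi>\<close> would be rational (lemma \<open>determinant_frequently_nonzero\<close>). A zero resultant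
  is inherited across a zero determinant, because the plane spanned by two consecutive polynomials does
  not change (lemma \<open>resultant_propagates\<close>). Hence, if a non-zero determinant were always followed by a
  zero resultant, all resultants would vanish from some point on. At a later non-zero determinant
  the polynomial \<open>P\<^sub>n\<^sub>+\<^sub>1\<close> would then have two distinct rational roots, one shared with \<open>P\<^sub>n\<close> and one with
  \<open>P\<^sub>n\<^sub>+\<^sub>2\<close>, both of which are closer to \<open>\<xi>\<close> than the size of their denominators permits (lemma
  \<open>resultants_not_both_zero\<close>).
\<close>

section \<open>The exponent\<close>

definition golden :: real where
  "golden = (1 + sqrt 5) / 2"

lemma golden_square: "golden\<^sup>2 = golden + 1"
proof -
  have "(sqrt 5)\<^sup>2 = (5::real)" by simp
  thus ?thesis unfolding golden_def by (simp add: power2_eq_square field_simps)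
qed

lemma golden_ge: "21 / 13 \<le> golden"
proof -
  have "29 / 13 \<le> sqrt (5::real)" by (rule real_le_rsqrt) (simp add: power2_eq_square)
  thus ?thesis by (simp add: golden_def)
qed

text \<open>
  The right-hand side has to lie below 2/3, the reciprocal of the coefficient 3/2 in \<open>resultant_bound\<close>.
  The base is slightly less than 2, which leaves room for the error term in \<open>determinant_bound\<close>, and
  8/13 is a convergent of \<open>golden - 1\<close> that lies below it, so that the inequality becomes one
  between integral powers.
\<close>

lemma powr_golden_bound: "(39/20 :: real) powr (1 - golden) \<le> 83/125"
proof -
  have "(39/20 :: real) powr (1 - golden) \<le> (39/20) powr (- (8/13))"
    using golden_ge by (intro powr_mono) auto
  also have "\<dots> \<le> 83/125"
  proof (rule power_le_imp_le_base)
    have "((39/20 :: real) powr (- (8/13))) ^ Suc 12 = (39/20) powr (- 8)"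
      by (simp add: powr_realpow[symmetric] powr_powr del: power_Suc)
    also have "\<dots> = 1 / (39/20) ^ 8"
      by (simp add: powr_minus_divide)
    also have "\<dots> \<le> (83/125) ^ Suc 12" by (simp add: power_divide)
    finally show "((39/20 :: real) powr (- (8/13))) ^ Suc 12 \<le> (83/125) ^ Suc 12" .
  qed simp
  finally show ?thesis .
qed

text \<open>
  The numerical core: the premise and the negated conclusion are what a non-zero determinant and a
  non-zero resultant imply for consecutive heights \<open>x \<le> y\<close>. The premise gives
  \<open>y \<ge> 39/20 * x powr golden\<close>; inserting this makes the middle term of the conclusion at most 249/250, by
  \<open>golden * (1 - golden) = -1\<close>, while the two outer terms are at most \<open>x powr (1 - golden)\<close>, which
  tends to 0.
\<close>

lemma determinant_excludes_resultant:
  "\<forall>\<^sub>F x in at_top. \<forall>y\<ge>x. 1 \<le> 1/2 * x powr (- golden) * y + x * y powr (- golden) \<longrightarrow>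
     1/4 * y powr (- 2 * golden) + 3/2 * x * y powr (1 - golden)
       + 3/2 * x\<^sup>2 * y powr (- golden) < 1"
proof -
  have "((\<lambda>x::real. x powr (1 - golden)) \<longlongrightarrow> 0) at_top"
    using golden_ge by (intro tendsto_neg_powr filterlim_ident) auto
  hence small: "\<forall>\<^sub>F x::real in at_top. x powr (1 - golden) < 1/2000"
    by (rule order_tendstoD) simp
  from small eventually_gt_at_top[of "1::real"] show ?thesis
  proof eventually_elim
    case (elim x)
    define e where "e = x powr (1 - golden)"
    have e: "0 \<le> e" "e < 1/2000" using elim by (auto simp: e_def)
    have x_pos: "0 < x" using elim by simp
    show ?case
    proof (intro allI impI)
      fix y assume "y \<ge> x" and det: "1 \<le> 1/2 * x powr (- golden) * y + x * y powr (- golden)"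
      have y: "y \<ge> x" "y > 1" using elim \<open>y \<ge> x\<close> by auto
      have "x * y powr (- golden) \<le> x * x powr (- golden)"
        using y elim golden_ge by (intro mult_left_mono powr_mono2') auto
      also have "\<dots> = e" using x_pos by (simp add: e_def powr_diff powr_minus divide_inverse)
      finally have "39/20 \<le> x powr (- golden) * y" using det e by simp
      hence y_ge: "39/20 * x powr golden \<le> y"
        using x_pos by (simp add: powr_minus field_simps)
      have pos: "0 < 39/20 * x powr golden" using x_pos by simp
      have g: "golden * (1 - golden) = -1" "golden * golden = golden + 1"
        using golden_square by (auto simp: power2_eq_square algebra_simps)
      have "x * y powr (1 - golden) \<le> x * (39/20 * x powr golden) powr (1 - golden)"
        using y_ge pos golden_ge x_pos by (intro mult_left_mono powr_mono2') auto
      also have "\<dots> = (39/20) powr (1 - golden)"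
        using x_pos unfolding powr_mult[of _ "x powr golden"] powr_powr g
        by (simp add: powr_minus)
      finally have main: "x * y powr (1 - golden) \<le> 83/125" using powr_golden_bound by linarith
      have "x powr golden \<le> y"
        using y_ge powr_ge_zero[of x golden] by linarith
      hence "x\<^sup>2 * y powr (- golden) \<le> x\<^sup>2 * (x powr golden) powr (- golden)"
        using golden_ge x_pos by (intro mult_left_mono powr_mono2') auto
      also have "\<dots> = x powr (2 + (- (golden + 1)))"
        using x_pos by (simp only: powr_add powr_powr) (simp add: g)
      also have "2 + (- (golden + 1)) = 1 - golden" by simp
      finally have second: "x\<^sup>2 * y powr (- golden) \<le> e" by (simp add: e_def)
      have "y powr (- 2 * golden) \<le> x powr (- 2 * golden)"
        using y x_pos golden_ge by (intro powr_mono2') auto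
      also have "\<dots> \<le> e"
        unfolding e_def using elim golden_ge by (intro powr_mono) auto
      finally show "1/4 * y powr (- 2 * golden) + 3/2 * x * y powr (1 - golden)
       + 3/2 * x\<^sup>2 * y powr (- golden) < 1"
        using main second e by linarith
    qed
  qed
qed

section \<open>Integral quadratic polynomials\<close>

definition qval :: "complex \<Rightarrow> int \<Rightarrow> int \<Rightarrow> int \<Rightarrow> complex" where
  "qval \<xi> a b c = of_int a + of_int b * \<xi> + of_int c * \<xi>\<^sup>2"

definition qheight :: "int \<Rightarrow> int \<Rightarrow> int \<Rightarrow> real" where
  "qheight a b c = real_of_int (max \<bar>a\<bar> (max \<bar>b\<bar> \<bar>c\<bar>))"

lemma qheight_bounds:
  "\<bar>real_of_int a\<bar> \<le> qheight a b c" "\<bar>real_of_int b\<bar> \<le> qheight a b c"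
  "\<bar>real_of_int c\<bar> \<le> qheight a b c"
  unfolding qheight_def by linarith+

lemma finite_qheight_le: "finite {(a, b, c). qheight a b c \<le> B}"
proof (rule finite_subset)
  let ?I = "{- \<lceil>B\<rceil>..\<lceil>B\<rceil>}"
  show "{(a, b, c). qheight a b c \<le> B} \<subseteq> ?I \<times> ?I \<times> ?I"
    unfolding qheight_def by clarsimp linarith
qed auto

text \<open>
  On the left is the resultant of two polynomials of degree at most 2, written in the \<open>2 \<times> 2\<close> minors of
  their coefficients. It is invariant under translation, so it can be computed from the Taylor
  coefficients at \<open>\<xi>\<close>, and every term then contains a value at \<open>\<xi>\<close>. The first summand is quadratic in
  these values and will be negligible.
\<close>

lemma resultant_taylor:
  "of_int ((a * c' - c * a')\<^sup>2 - (a * b' - b * a') * (b * c' - c * b')) =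
     (qval \<xi> a b c * of_int c' - of_int c * qval \<xi> a' b' c')\<^sup>2
     - of_int (b * c' - c * b') *
         (qval \<xi> a b c * (of_int b' + 2 * \<xi> * of_int c')
          - qval \<xi> a' b' c' * (of_int b + 2 * \<xi> * of_int c))"
  by (simp add: qval_def power2_eq_square algebra_simps)

lemma minor_bound:
  fixes b c b' c' :: int and H H' :: real
  assumes "\<bar>real_of_int b\<bar> \<le> H" "\<bar>real_of_int c\<bar> \<le> H"
    and "\<bar>real_of_int b'\<bar> \<le> H'" "\<bar>real_of_int c'\<bar> \<le> H'"
  shows "\<bar>real_of_int (b * c' - c * b')\<bar> \<le> 2 * H * H'"
proof -
  have "\<bar>real_of_int b\<bar> * \<bar>real_of_int c'\<bar> \<le> H * H'"
    using assms by (intro mult_mono) auto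
  moreover have "\<bar>real_of_int c\<bar> * \<bar>real_of_int b'\<bar> \<le> H * H'"
    using assms by (intro mult_mono) auto
  ultimately show ?thesis
    using abs_triangle_ineq4[of "real_of_int (b * c')" "real_of_int (c * b')"]
    by (simp add: abs_mult)
qed

text \<open>
  When the resultant vanishes, the minors satisfy \<open>v\<^sup>2 = u * w\<close>. The rational point \<open>x / y\<close> that
  parametrises this conic is then the common root of the two polynomials. The integrality of \<open>t\<close> is
  what later turns smallness of a minor expression into closeness of the root to \<open>\<xi>\<close>.
\<close>

lemma rational_point_of_conic:
  fixes u v w :: int
  assumes "w \<noteq> 0" and "v\<^sup>2 = u * w"
  obtains t x y where "t \<noteq> 0" "y \<noteq> 0" "coprime x y"
    "w = t * y\<^sup>2" "v = - (t * x * y)" "u = t * x\<^sup>2"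
proof -
  define g where "g = gcd v w"
  have g0: "g \<noteq> 0" using assms by (simp add: g_def)
  obtain v' y where vy: "v = v' * g" "w = y * g" "coprime v' y"
    using gcd_coprime_exists[of v w] g0 unfolding g_def by blast
  have y0: "y \<noteq> 0" using assms vy by auto
  have "g * (v'\<^sup>2 * g) = g * (u * y)"
    using assms(2) by (simp add: vy power2_eq_square algebra_simps)
  hence eq: "v'\<^sup>2 * g = u * y" using g0 by simp
  hence "y dvd v'\<^sup>2 * g" by simp
  moreover have "coprime y (v'\<^sup>2)" using vy(3) by (simp add: coprime_commute)
  ultimately have "y dvd g" using coprime_dvd_mult_right_iff by blast
  then obtain t where t: "g = y * t" by (elim dvdE)
  have "y * (v'\<^sup>2 * t) = y * u" using eq by (simp add: t mult_ac)
  hence "u = t * v'\<^sup>2" using y0 by (simp add: mult.commute)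
  thus ?thesis
    using that[of t y "- v'"] vy t g0 y0 by (simp add: power2_eq_square mult.commute mult.left_commute)
qed

section \<open>Sequences of minimal polynomials\<close>

text \<open>
  In \<open>value_le\<close> a value is bounded in terms of the next height: this is the trace that the minimal
  choice of the next polynomial leaves.
\<close>

locale minimal_sequence =
  fixes \<xi> :: complex and a b c :: "nat \<Rightarrow> int" and v :: "nat \<Rightarrow> complex" and X :: "nat \<Rightarrow> real"
  defines "v n \<equiv> qval \<xi> (a n) (b n) (c n)"
    and "X n \<equiv> qheight (a n) (b n) (c n)"
  assumes value_decreasing: "cmod (v (Suc n)) < cmod (v n)"
    and height_mono: "X n \<le> X (Suc n)"
    and height_at_top: "filterlim X at_top sequentially"
    and value_le: "cmod (v n) \<le> 1/4 * X (Suc n) powr (- (golden\<^sup>2))"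
    and height_gt_1: "1 < X n"
    and irrational: "of_int p + of_int q * \<xi> = 0 \<Longrightarrow> q = 0"
begin

definition m01 :: "nat \<Rightarrow> int" where "m01 n = a n * b (Suc n) - b n * a (Suc n)"
definition m02 :: "nat \<Rightarrow> int" where "m02 n = a n * c (Suc n) - c n * a (Suc n)"
definition m12 :: "nat \<Rightarrow> int" where "m12 n = b n * c (Suc n) - c n * b (Suc n)"

definition resultant :: "nat \<Rightarrow> int" where
  "resultant n = (m02 n)\<^sup>2 - m01 n * m12 n"

definition determinant :: "nat \<Rightarrow> int" where
  "determinant n = a n * m12 (Suc n) - b n * m02 (Suc n) + c n * m01 (Suc n)"

lemma coeff_bounds:
  "\<bar>real_of_int (a n)\<bar> \<le> X n" "\<bar>real_of_int (b n)\<bar> \<le> X n" "\<bar>real_of_int (c n)\<bar> \<le> X n"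
  unfolding X_def by (rule qheight_bounds)+

lemma value_height_le:
  "cmod (v n) * X (Suc n) \<le> 1/4 * X (Suc n) powr (- golden)"
proof -
  have "cmod (v n) * X (Suc n) \<le> 1/4 * X (Suc n) powr (- (golden\<^sup>2)) * X (Suc n)"
    using value_le[of n] height_gt_1[of "Suc n"] by (intro mult_right_mono) auto
  also have "\<dots> = 1/4 * X (Suc n) powr (- (golden\<^sup>2) + 1)"
    using height_gt_1[of "Suc n"] by (simp only: powr_add) simp
  also have "- (golden\<^sup>2) + 1 = - golden" by (simp add: golden_square)
  finally show ?thesis .
qed

lemma value_combination_bound:
  assumes "\<bar>real_of_int p\<bar> \<le> X (Suc n)" "\<bar>real_of_int q\<bar> \<le> X n"
  shows "cmod (v n * of_int p - of_int q * v (Suc n)) \<le> 2 * (cmod (v n) * X (Suc n))"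
proof -
  have "cmod (v n * of_int p) \<le> cmod (v n) * X (Suc n)"
    using assms by (simp add: norm_mult mult_left_mono)
  moreover have "cmod (of_int q * v (Suc n)) \<le> X (Suc n) * cmod (v n)"
    unfolding norm_mult using assms height_mono[of n] value_decreasing[of n] height_gt_1[of n]
    by (intro mult_mono) auto
  ultimately show ?thesis
    using norm_triangle_ineq4[of "v n * of_int p" "of_int q * v (Suc n)"]
    by (simp add: mult.commute)
qed

lemma minor_values:
  "of_int (m02 n) + \<xi> * of_int (m12 n) = v n * of_int (c (Suc n)) - of_int (c n) * v (Suc n)"
  "of_int (m01 n) - \<xi>\<^sup>2 * of_int (m12 n) = v n * of_int (b (Suc n)) - of_int (b n) * v (Suc n)"
  unfolding m01_def m02_def m12_def v_def
  by (simp_all add: qval_def power2_eq_square algebra_simps)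

text \<open>
  The triple of minors is an integral point close to the line spanned by \<open>(\<xi>\<^sup>2, -\<xi>, 1)\<close>, which contains
  the minors \<open>(m01, m02, m12)\<close> of any two polynomials of degree at most 2 that vanish at \<open>\<xi>\<close>.
\<close>

lemma minor_near_multiple:
  "cmod (of_int (m02 n) + \<xi> * of_int (m12 n)) \<le> 1/2 * X (Suc n) powr (- golden)"
  "cmod (of_int (m01 n) - \<xi>\<^sup>2 * of_int (m12 n)) \<le> 1/2 * X (Suc n) powr (- golden)"
  unfolding minor_values
  using value_combination_bound[OF coeff_bounds(3)[of "Suc n"] coeff_bounds(3)[of n]]
    value_combination_bound[OF coeff_bounds(2)[of "Suc n"] coeff_bounds(2)[of n]]
    value_height_le[of n] by linarith+

lemma powr_height_less_1: "e < 0 \<Longrightarrow> X n powr e < 1"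
  using height_gt_1[of n] powr_less_mono[of e 0 "X n"] by simp

text \<open>
  If \<open>m12\<close> were 0, the other two minors would be integers of absolute value less than 1, hence 0, and
  the two polynomials would be proportional. That is impossible because the later one has the larger
  height but the smaller value at \<open>\<xi>\<close>.
\<close>

lemma m12_nonzero: "m12 n \<noteq> 0"
proof
  assume m12: "m12 n = 0"
  have small: "1/2 * X (Suc n) powr (- golden) < 1"
    using powr_height_less_1[of "- golden" "Suc n"] golden_ge by simp
  have m02: "m02 n = 0" and m01: "m01 n = 0"
    using minor_near_multiple[of n] small by (simp_all add: m12)
  have proportional: "of_int (c (Suc n)) * v n = of_int (c n) * v (Suc n)"
    "of_int (b (Suc n)) * v n = of_int (b n) * v (Suc n)"
    using minor_values[of n] by (simp_all add: m12 m02 m01 mult.commute)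
  have "of_int (a (Suc n)) * v n - of_int (a n) * v (Suc n) =
      - of_int (m01 n) * \<xi> - of_int (m02 n) * \<xi>\<^sup>2"
    unfolding v_def qval_def m01_def m02_def by (simp add: algebra_simps)
  hence proportional_a: "of_int (a (Suc n)) * v n = of_int (a n) * v (Suc n)"
    by (simp add: m01 m02)
  have coeff: "\<bar>real_of_int q\<bar> * cmod (v n) \<le> X n * cmod (v (Suc n))"
    if "of_int q * v n = of_int p * v (Suc n)" "\<bar>real_of_int p\<bar> \<le> X n" for p q :: int
  proof -
    have "\<bar>real_of_int q\<bar> * cmod (v n) = \<bar>real_of_int p\<bar> * cmod (v (Suc n))"
      using arg_cong[OF that(1), of cmod] by (simp add: norm_mult)
    thus ?thesis using that(2) by (simp add: mult_right_mono)
  qed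
  have "X (Suc n) * cmod (v n) \<le> X n * cmod (v (Suc n))"
    using coeff[OF proportional(1) coeff_bounds(3)] coeff[OF proportional(2) coeff_bounds(2)]
      coeff[OF proportional_a coeff_bounds(1)]
    unfolding X_def[of "Suc n"] qheight_def by (simp add: max_def split: if_splits)
  moreover have "X n * cmod (v (Suc n)) < X n * cmod (v n)"
    using value_decreasing[of n] height_gt_1[of n] by simp
  moreover have "X n * cmod (v n) \<le> X (Suc n) * cmod (v n)"
    using height_mono[of n] by (simp add: mult_right_mono)
  ultimately show False by linarith
qed

text \<open>
  The minors are the coordinates of the plane spanned by two consecutive polynomials. With a zero
  determinant this plane is the same for the indices \<open>n\<close> and \<open>Suc n\<close>; in terms of cross products,
  \<open>(P \<times> Q) \<times> (Q \<times> R)\<close> equals \<open>det (P, Q, R)\<close> times \<open>Q\<close>.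
\<close>

lemma minors_proportional:
  assumes "determinant n = 0"
  shows "m02 n * m12 (Suc n) = m02 (Suc n) * m12 n"
    and "m01 n * m12 (Suc n) = m01 (Suc n) * m12 n"
proof -
  have "m02 n * m12 (Suc n) - m02 (Suc n) * m12 n = c (Suc n) * determinant n"
    unfolding determinant_def m01_def m02_def m12_def by (simp add: algebra_simps)
  thus "m02 n * m12 (Suc n) = m02 (Suc n) * m12 n" using assms by simp
  have "m01 n * m12 (Suc n) - m01 (Suc n) * m12 n = b (Suc n) * determinant n"
    unfolding determinant_def m01_def m02_def m12_def by (simp add: algebra_simps)
  thus "m01 n * m12 (Suc n) = m01 (Suc n) * m12 n" using assms by simp
qed

lemma resultant_propagates:
  assumes "determinant n = 0" "resultant n = 0"
  shows "resultant (Suc n) = 0"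
proof -
  note p = minors_proportional[OF assms(1)]
  have "(m12 n)\<^sup>2 * resultant (Suc n) =
      (m02 (Suc n) * m12 n)\<^sup>2 - (m01 (Suc n) * m12 n) * m12 n * m12 (Suc n)"
    unfolding resultant_def by (simp add: power2_eq_square algebra_simps)
  also have "\<dots> = (m12 (Suc n))\<^sup>2 * resultant n"
    unfolding p[symmetric] resultant_def by (simp add: power2_eq_square algebra_simps)
  finally show ?thesis using assms m12_nonzero[of n] by simp
qed

text \<open>
  Otherwise the ratio \<open>m02 / m12\<close> is eventually constant, while it tends to \<open>-\<xi>\<close>, so \<open>\<xi>\<close> is rational.
\<close>

lemma determinant_frequently_nonzero: "\<exists>n\<ge>N. determinant n \<noteq> 0"
proof (rule ccontr)
  assume "\<not> ?thesis"
  hence zero: "determinant n = 0" if "n \<ge> N" for n using that by auto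
  define s where "s = (of_int (m02 N) / of_int (m12 N) :: complex)"
  have ratio: "of_int (m02 n) = s * of_int (m12 n)" if "n \<ge> N" for n
    using that
  proof (induction n rule: dec_induct)
    case base
    show ?case using m12_nonzero[of N] by (simp add: s_def)
  next
    case (step n)
    have "(of_int (m02 n * m12 (Suc n)) :: complex) = of_int (m02 (Suc n) * m12 n)"
      using minors_proportional(1)[OF zero] step by simp
    thus ?case using step m12_nonzero[of n] by simp
  qed
  have bound: "cmod (s + \<xi>) \<le> 1/2 * X (Suc n) powr (- golden)" if "n \<ge> N" for n
  proof -
    have "1 \<le> \<bar>real_of_int (m12 n)\<bar>" using m12_nonzero[of n] by linarith
    hence "cmod (s + \<xi>) \<le> cmod (s + \<xi>) * \<bar>real_of_int (m12 n)\<bar>"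
      using mult_left_mono[of 1 "\<bar>real_of_int (m12 n)\<bar>" "cmod (s + \<xi>)"] by simp
    also have "\<dots> = cmod (of_int (m02 n) + \<xi> * of_int (m12 n))"
      unfolding ratio[OF that] distrib_right[symmetric] by (simp add: norm_mult)
    finally show ?thesis using minor_near_multiple(1)[of n] by linarith
  qed
  have "(\<lambda>n. 1/2 * X (Suc n) powr (- golden)) \<longlonglongrightarrow> 1/2 * 0"
    using golden_ge height_at_top
    by (intro tendsto_mult tendsto_const tendsto_neg_powr) (auto simp: filterlim_sequentially_Suc)
  hence "cmod (s + \<xi>) \<le> 1/2 * 0"
    by (rule tendsto_lowerbound) (use bound in \<open>blast intro: eventually_sequentiallyI[of N]\<close>, simp)
  hence "s + \<xi> = 0" by simp
  hence "of_int (m02 N) + of_int (m12 N) * \<xi> = 0"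
    using ratio[of N] by (metis add.commute distrib_left mult.commute mult_zero_right order_refl)
  thus False using irrational m12_nonzero by blast
qed

lemma determinant_taylor:
  "of_int (determinant n) = v n * of_int (m12 (Suc n))
     - v (Suc n) * of_int (b n * c (Suc (Suc n)) - c n * b (Suc (Suc n)))
     + v (Suc (Suc n)) * of_int (m12 n)"
  unfolding determinant_def m01_def m02_def m12_def v_def
  by (simp add: qval_def algebra_simps)

text \<open>
  Of the three terms of \<open>determinant_taylor\<close> the first dominates, as \<open>v n\<close> is the largest value and its
  cofactor involves the two largest heights. It gives the main term, whose coefficient 1/2 is
  twice the constant 1/4 of the hypothesis.
\<close>

lemma determinant_bound:
  assumes "determinant n \<noteq> 0"
  shows "1 \<le> 1/2 * X (Suc n) powr (- golden) * X (Suc (Suc n))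
      + X (Suc n) * X (Suc (Suc n)) powr (- golden)"
proof -
  let ?w = "X n" and ?x = "X (Suc n)" and ?y = "X (Suc (Suc n))"
  let ?l = "cmod (v n)" and ?l' = "cmod (v (Suc n))" and ?l'' = "cmod (v (Suc (Suc n)))"
  have h: "0 < ?w" "?w \<le> ?x" "?x \<le> ?y"
    using height_gt_1[of n] height_mono[of n] height_mono[of "Suc n"] by auto
  have "1 \<le> cmod (of_int (determinant n))"
    using assms by simp
  also have "\<dots> \<le> cmod (v n * of_int (m12 (Suc n)))
     + cmod (v (Suc n) * of_int (b n * c (Suc (Suc n)) - c n * b (Suc (Suc n))))
     + cmod (v (Suc (Suc n)) * of_int (m12 n))"
    unfolding determinant_taylor by (intro norm_triangle_mono norm_triangle_le_diff) auto
  also have "\<dots> \<le> ?l * (2 * ?x * ?y) + ?l' * (2 * ?w * ?y) + ?l'' * (2 * ?w * ?x)"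
    unfolding norm_mult norm_of_int m12_def
    by (intro add_mono mult_left_mono minor_bound coeff_bounds norm_ge_zero)
  also have "\<dots> \<le> ?l * (2 * ?x * ?y) + ?l' * (2 * ?x * ?y) + ?l' * (2 * ?x * ?y)"
    using h value_decreasing[of "Suc n"] by (intro add_mono mult_mono order_refl) auto
  also have "\<dots> = 2 * (?l * ?x) * ?y + 4 * ?x * (?l' * ?y)" by simp
  also have "\<dots> \<le> 2 * (1/4 * ?x powr (- golden)) * ?y + 4 * ?x * (1/4 * ?y powr (- golden))"
    using h by (intro add_mono mult_right_mono mult_left_mono value_height_le) auto
  finally show ?thesis by simp
qed

text \<open>
  The condition on \<open>\<xi>\<close> bounds the derivatives \<open>b + 2 * \<xi> * c\<close> by three times the height. The
  coefficient of the main term is the product of this 3, the 2 of \<open>minor_bound\<close> and the constant 1/4.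
\<close>

lemma resultant_bound:
  assumes "cmod \<xi> \<le> 1" and "resultant n \<noteq> 0"
  shows "1 \<le> 1/4 * X (Suc n) powr (- 2 * golden) + 3/2 * X n * X (Suc n) powr (1 - golden)
       + 3/2 * (X n)\<^sup>2 * X (Suc n) powr (- golden)"
proof -
  let ?x = "X n" and ?y = "X (Suc n)" and ?l = "cmod (v n)" and ?l' = "cmod (v (Suc n))"
  let ?p = "?y powr (- golden)"
  have h: "0 < ?x" "?x \<le> ?y" using height_gt_1[of n] height_mono[of n] by auto
  have deriv: "cmod (of_int (b k) + 2 * \<xi> * of_int (c k)) \<le> 3 * X k" for k
  proof -
    have "cmod (of_int (b k) + 2 * \<xi> * of_int (c k)) \<le>
        \<bar>real_of_int (b k)\<bar> + 2 * (cmod \<xi> * \<bar>real_of_int (c k)\<bar>)"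
      by (rule norm_triangle_le) (simp add: norm_mult)
    also have "cmod \<xi> * \<bar>real_of_int (c k)\<bar> \<le> 1 * X k"
      using assms(1) coeff_bounds by (intro mult_mono) auto
    finally show ?thesis using coeff_bounds(2)[of k] by simp
  qed
  let ?A = "v n * of_int (c (Suc n)) - of_int (c n) * v (Suc n)"
  let ?W = "v n * (of_int (b (Suc n)) + 2 * \<xi> * of_int (c (Suc n)))
          - v (Suc n) * (of_int (b n) + 2 * \<xi> * of_int (c n))"
  have A: "cmod ?A \<le> 1/2 * ?p"
    using minor_near_multiple(1)[of n] unfolding minor_values .
  have W: "cmod ?W \<le> ?l * (3 * ?y) + ?l * (3 * ?x)"
    unfolding norm_mult using value_decreasing[of n] deriv
    by (intro norm_triangle_le_diff add_mono) (auto simp: norm_mult intro!: mult_mono)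
  have "1 \<le> cmod (of_int (resultant n))"
    using assms by simp
  also have "of_int (resultant n) = ?A\<^sup>2 - of_int (m12 n) * ?W"
    unfolding resultant_def m01_def m02_def m12_def v_def by (rule resultant_taylor)
  also have "cmod (?A\<^sup>2 - of_int (m12 n) * ?W) \<le> (cmod ?A)\<^sup>2 + \<bar>real_of_int (m12 n)\<bar> * cmod ?W"
    by (rule norm_triangle_le_diff) (simp add: norm_mult norm_power)
  also have "\<dots> \<le> (1/2 * ?p)\<^sup>2 + (2 * ?x * ?y) * (?l * (3 * ?y) + ?l * (3 * ?x))"
    using A W h unfolding m12_def
    by (intro add_mono power_mono mult_mono minor_bound coeff_bounds) auto
  also have "\<dots> = (1/2 * ?p)\<^sup>2 + 6 * ?x * (?x + ?y) * (?l * ?y)"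
    by (simp add: algebra_simps)
  also have "\<dots> \<le> (1/2 * ?p)\<^sup>2 + 6 * ?x * (?x + ?y) * (1/4 * ?p)"
    using h value_height_le[of n] by (intro add_mono mult_left_mono order_refl) auto
  also have "\<dots> = 1/4 * ?p\<^sup>2 + 3/2 * ?x * (?y * ?p) + 3/2 * ?x\<^sup>2 * ?p"
    by (simp add: power2_eq_square algebra_simps)
  also have "?p\<^sup>2 = ?y powr (- 2 * golden)"
    by (simp add: power2_eq_square powr_add[symmetric])
  also have "?y * ?p = ?y powr (1 - golden)"
    using h by (simp add: powr_diff powr_minus divide_inverse)
  finally show ?thesis .
qed

text \<open>
  With both resultants zero, \<open>P\<^sub>n\<^sub>+\<^sub>1\<close> has a root \<open>x / y\<close> in common with \<open>P\<^sub>n\<close> and a root \<open>x' / y'\<close> in common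
  with \<open>P\<^sub>n\<^sub>+\<^sub>2\<close>. They differ, as a common root of all three polynomials would make the determinant 0.
  Hence \<open>x * y' - x' * y\<close> is a non-zero integer. It is also small: the linear forms
  \<open>y * \<xi> - x\<close> and \<open>y' * \<xi> - x'\<close> divide minor expressions that are small by \<open>minor_near_multiple\<close>, and the
  denominators divide the leading coefficient of \<open>P\<^sub>n\<^sub>+\<^sub>1\<close>.
\<close>

lemma resultants_not_both_zero:
  assumes "determinant n \<noteq> 0" and "resultant n = 0"
  shows "resultant (Suc n) \<noteq> 0"
proof
  assume res': "resultant (Suc n) = 0"
  let ?a = "a (Suc n)" and ?b = "b (Suc n)" and ?c = "c (Suc n)" and ?x = "X (Suc n)"
  have conic: "(m02 n)\<^sup>2 = m01 n * m12 n" "(m02 (Suc n))\<^sup>2 = m01 (Suc n) * m12 (Suc n)"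
    using assms(2) res' by (simp_all add: resultant_def)
  obtain t x y where txy: "t \<noteq> 0" "y \<noteq> 0" "coprime x y"
    "m12 n = t * y\<^sup>2" "m02 n = - (t * x * y)" "m01 n = t * x\<^sup>2"
    using rational_point_of_conic[OF m12_nonzero conic(1)] by blast
  obtain t' x' y' where txy': "t' \<noteq> 0" "y' \<noteq> 0" "coprime x' y'"
    "m12 (Suc n) = t' * y'\<^sup>2" "m02 (Suc n) = - (t' * x' * y')" "m01 (Suc n) = t' * x'\<^sup>2"
    using rational_point_of_conic[OF m12_nonzero conic(2)] by blast
  have "t * (a n * y\<^sup>2 + b n * x * y + c n * x\<^sup>2) = a n * m12 n - b n * m02 n + c n * m01 n"
    by (simp add: txy algebra_simps)
  also have "\<dots> = 0" by (simp add: m01_def m02_def m12_def algebra_simps)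
  finally have root_prev: "a n * y\<^sup>2 + b n * x * y + c n * x\<^sup>2 = 0" using txy by simp
  have "t * (?a * y\<^sup>2 + ?b * x * y + ?c * x\<^sup>2) = ?a * m12 n - ?b * m02 n + ?c * m01 n"
    by (simp add: txy algebra_simps)
  also have "\<dots> = 0" by (simp add: m01_def m02_def m12_def algebra_simps)
  finally have root: "?a * y\<^sup>2 + ?b * x * y + ?c * x\<^sup>2 = 0" using txy by simp
  have "t' * (?a * y'\<^sup>2 + ?b * x' * y' + ?c * x'\<^sup>2)
      = ?a * m12 (Suc n) - ?b * m02 (Suc n) + ?c * m01 (Suc n)"
    by (simp add: txy' algebra_simps)
  also have "\<dots> = 0" by (simp add: m01_def m02_def m12_def algebra_simps)
  finally have root': "?a * y'\<^sup>2 + ?b * x' * y' + ?c * x'\<^sup>2 = 0" using txy' by simp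
  have distinct: "x * y' \<noteq> x' * y"
  proof
    assume eq: "x * y' = x' * y"
    have "y\<^sup>2 * determinant n = t' * (a n * y\<^sup>2 * y'\<^sup>2 + b n * (x' * y) * y * y' + c n * (x' * y)\<^sup>2)"
      unfolding determinant_def by (simp add: txy' power2_eq_square algebra_simps)
    also have "\<dots> = t' * y'\<^sup>2 * (a n * y\<^sup>2 + b n * x * y + c n * x\<^sup>2)"
      unfolding eq[symmetric] by (simp add: power2_eq_square algebra_simps)
    also have "\<dots> = 0" unfolding root_prev by simp
    finally show False using assms(1) txy by simp
  qed
  have denominator_dvd: "q dvd ?c" if "coprime p q" "?a * q\<^sup>2 + ?b * p * q + ?c * p\<^sup>2 = 0" for p q
  proof -
    have "?c * p\<^sup>2 = q * (- ?a * q - ?b * p)"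
      using that(2) by (simp add: power2_eq_square algebra_simps)
    hence "q dvd ?c * p\<^sup>2" by simp
    moreover have "coprime q (p\<^sup>2)" using that(1) by (simp add: coprime_commute)
    ultimately show ?thesis using coprime_dvd_mult_left_iff by blast
  qed
  \<comment> \<open>A polynomial of degree at most 1 cannot have two distinct roots.\<close>
  have "?c \<noteq> 0"
  proof
    assume c0: "?c = 0"
    have "y * (?a * y + ?b * x) = 0" "y' * (?a * y' + ?b * x') = 0"
      using root root' by (simp_all add: c0 power2_eq_square algebra_simps)
    hence lin: "?a * y + ?b * x = 0" "?a * y' + ?b * x' = 0" using txy txy' by auto
    have "?b * (x * y' - x' * y) = (?a * y + ?b * x) * y' - (?a * y' + ?b * x') * y"
      by (simp add: algebra_simps)
    hence "?b = 0" using lin distinct by simp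
    hence "m12 n = 0" by (simp add: m12_def c0)
    thus False using m12_nonzero by blast
  qed
  hence denominators: "\<bar>real_of_int y\<bar> \<le> ?x" "\<bar>real_of_int y'\<bar> \<le> ?x"
    using dvd_imp_le_int[OF _ denominator_dvd[OF txy(3) root]]
      dvd_imp_le_int[OF _ denominator_dvd[OF txy'(3) root']] coeff_bounds(3)[of "Suc n"]
    by linarith+
  have near: "cmod (of_int q * \<xi> - of_int p) \<le> 1/2 * ?x powr (- golden)"
    if "s \<noteq> 0" "q \<noteq> 0" "m12 k = s * q\<^sup>2" "m02 k = - (s * p * q)" "k \<ge> n" "k \<le> Suc n"
    for s p q k
  proof -
    have "1 \<le> \<bar>s * q\<bar>" using that by (simp add: abs_mult Suc_leI int_one_le_iff_zero_less)
    hence "1 \<le> \<bar>real_of_int (s * q)\<bar>" by linarith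
    hence "cmod (of_int q * \<xi> - of_int p)
        \<le> \<bar>real_of_int (s * q)\<bar> * cmod (of_int q * \<xi> - of_int p)"
      using mult_right_mono[of 1 _ "cmod (of_int q * \<xi> - of_int p)"] by fastforce
    also have "\<dots> = cmod (of_int (s * q) * (of_int q * \<xi> - of_int p))"
      by (simp add: norm_mult abs_mult)
    also have "of_int (s * q) * (of_int q * \<xi> - of_int p) = of_int (m02 k) + \<xi> * of_int (m12 k)"
      by (simp add: that power2_eq_square algebra_simps)
    also have "cmod \<dots> \<le> 1/2 * X (Suc k) powr (- golden)" by (rule minor_near_multiple)
    also have "X (Suc k) powr (- golden) \<le> ?x powr (- golden)"
    proof (rule powr_mono2')
      show "?x \<le> X (Suc k)"
        using that height_mono[of "Suc n"] by (cases "k = n") (auto simp: le_Suc_eq)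
    qed (use golden_ge height_gt_1[of "Suc n"] in auto)
    finally show ?thesis by simp
  qed
  let ?F = "of_int y * \<xi> - of_int x" and ?F' = "of_int y' * \<xi> - of_int x'"
  have "1 \<le> cmod (of_int (x * y' - x' * y))"
    unfolding norm_of_int using distinct by linarith
  also have "of_int (x * y' - x' * y) = of_int y * ?F' - of_int y' * ?F"
    by (simp add: algebra_simps)
  also have "cmod \<dots> \<le> \<bar>real_of_int y\<bar> * cmod ?F' + \<bar>real_of_int y'\<bar> * cmod ?F"
    by (rule norm_triangle_le_diff) (simp add: norm_mult)
  also have "\<dots> \<le> ?x * (1/2 * ?x powr (- golden)) + ?x * (1/2 * ?x powr (- golden))"
    using height_gt_1[of "Suc n"]
    by (intro add_mono mult_mono denominators near[OF txy(1,2,4,5)] near[OF txy'(1,2,4,5)]) auto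
  also have "\<dots> = ?x powr (1 - golden)"
    using powr_mult_base[of ?x "- golden"] height_gt_1[of "Suc n"] by simp
  also have "\<dots> < 1" using golden_ge by (intro powr_height_less_1) simp
  finally show False by simp
qed

lemma no_sequence_in_unit_disc:
  assumes "cmod \<xi> \<le> 1"
  shows False
proof -
  have "\<forall>\<^sub>F n in sequentially. \<forall>y\<ge>X n.
      1 \<le> 1/2 * X n powr (- golden) * y + X n * y powr (- golden) \<longrightarrow>
      1/4 * y powr (- 2 * golden) + 3/2 * X n * y powr (1 - golden)
       + 3/2 * (X n)\<^sup>2 * y powr (- golden) < 1"
    using height_at_top determinant_excludes_resultant by (rule eventually_compose_filterlim[rotated])
  then obtain N where N: "\<And>n y. n \<ge> N \<Longrightarrow> y \<ge> X n \<Longrightarrow>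
      1 \<le> 1/2 * X n powr (- golden) * y + X n * y powr (- golden) \<Longrightarrow>
      1/4 * y powr (- 2 * golden) + 3/2 * X n * y powr (1 - golden)
       + 3/2 * (X n)\<^sup>2 * y powr (- golden) < 1"
    unfolding eventually_sequentially by blast
  have vanish: "resultant (Suc n) = 0" if "n \<ge> N" "determinant n \<noteq> 0" for n
  proof (rule ccontr)
    assume "resultant (Suc n) \<noteq> 0"
    from resultant_bound[OF assms this]
      N[OF le_SucI[OF that(1)] height_mono determinant_bound[OF that(2)]]
    show False by linarith
  qed
  obtain i where i: "i \<ge> N" "determinant i \<noteq> 0" using determinant_frequently_nonzero by blast
  have zero: "resultant n = 0" if "n \<ge> Suc i" for n
    using that
  proof (induction n rule: dec_induct)
    case base
    show ?case using vanish i by blast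
  next
    case (step n)
    show ?case
    proof (cases "determinant n = 0")
      case True
      thus ?thesis using resultant_propagates step.IH by blast
    next
      case False
      thus ?thesis using vanish step.hyps i by simp
    qed
  qed
  obtain j where "j \<ge> Suc i" "determinant j \<noteq> 0" using determinant_frequently_nonzero by blast
  thus False using resultants_not_both_zero[of j] zero[of j] zero[of "Suc j"] by simp
qed

end

text \<open>
  Without a relation, a \<open>minimal_sequence\<close> can be built by always passing to a triple of least height
  among those with a smaller value. The heights tend to infinity because only finitely many triples
  have bounded height and no triple occurs twice.
\<close>

lemma integral_quadratic_relation:
  assumes "cmod \<xi> \<le> 1"
    and approx: "\<forall>\<^sub>F B in at_top. \<exists>p q r. (p, q, r) \<noteq> (0, 0, 0) \<and> qheight p q r \<le> B \<and>
        cmod (qval \<xi> p q r) \<le> 1/4 * B powr (- (golden\<^sup>2))"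
  shows "\<exists>p q r. (p, q, r) \<noteq> (0, 0, 0) \<and> qval \<xi> p q r = 0"
proof (rule ccontr)
  assume no_relation: "\<not> ?thesis"
  define V where "V t = cmod (case t of (p, q, r) \<Rightarrow> qval \<xi> p q r)" for t
  define H where "H t = (case t of (p, q, r) \<Rightarrow> qheight p q r)" for t
  define Z :: "int \<times> int \<times> int" where "Z = (0, 0, 0)"
  have V_pos: "V t > 0" if "t \<noteq> Z" for t
    using no_relation that by (cases t) (auto simp: V_def Z_def)
  obtain B0 where B0: "\<And>B. B \<ge> B0 \<Longrightarrow> \<exists>t. t \<noteq> Z \<and> H t \<le> B \<and> V t \<le> 1/4 * B powr (- (golden\<^sup>2))"
  proof -
    obtain B0 where B0: "\<And>B. B \<ge> B0 \<Longrightarrow> \<exists>p q r. (p, q, r) \<noteq> (0, 0, 0) \<and> qheight p q r \<le> B \<and>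
        cmod (qval \<xi> p q r) \<le> 1/4 * B powr (- (golden\<^sup>2))"
      using approx unfolding eventually_at_top_linorder by blast
    show ?thesis
    proof (rule that)
      fix B assume "B \<ge> B0"
      then obtain p q r where "(p, q, r) \<noteq> (0, 0, 0)" "qheight p q r \<le> B"
        "cmod (qval \<xi> p q r) \<le> 1/4 * B powr (- (golden\<^sup>2))" using B0 by blast
      thus "\<exists>t. t \<noteq> Z \<and> H t \<le> B \<and> V t \<le> 1/4 * B powr (- (golden\<^sup>2))"
        by (intro exI[of _ "(p, q, r)"]) (simp add: V_def H_def Z_def)
    qed
  qed
  have vanishing: "((\<lambda>B. 1/4 * B powr (- (golden\<^sup>2))) \<longlongrightarrow> 1/4 * 0) at_top"
    using golden_ge by (intro tendsto_mult tendsto_const tendsto_neg_powr filterlim_ident) simp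
  have smaller: "\<exists>s. s \<noteq> Z \<and> V s < V t" if "t \<noteq> Z" for t
  proof -
    have "\<forall>\<^sub>F B in at_top. B \<ge> B0 \<and> 1/4 * B powr (- (golden\<^sup>2)) < V t"
      using order_tendstoD(2)[OF vanishing, of "V t"] V_pos[OF that] eventually_ge_at_top[of B0]
      by (simp add: eventually_conj_iff)
    then obtain B where B: "B \<ge> B0" "1/4 * B powr (- (golden\<^sup>2)) < V t"
      using eventually_happens trivial_limit_at_top_linorder by blast
    obtain s where "s \<noteq> Z" "V s \<le> 1/4 * B powr (- (golden\<^sup>2))" using B0[OF B(1)] by blast
    thus ?thesis using B(2) by (meson order.strict_trans1)
  qed
  define step where "step t t' \<longleftrightarrow> V t' < V t \<and> (\<forall>s. s \<noteq> Z \<and> V s < V t \<longrightarrow> H t' \<le> H s)" for t t'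
  have "\<exists>t'. t' \<noteq> Z \<and> step t t'" if t: "t \<noteq> Z" for t
  proof -
    obtain s0 where "s0 \<noteq> Z \<and> V s0 < V t" using smaller[OF t] by blast
    then obtain t' where t': "t' \<noteq> Z \<and> V t' < V t"
      "\<And>s. s \<noteq> Z \<and> V s < V t \<Longrightarrow> nat \<lfloor>H t'\<rfloor> \<le> nat \<lfloor>H s\<rfloor>"
      using ex_has_least_nat[of "\<lambda>s. s \<noteq> Z \<and> V s < V t" s0 "\<lambda>s. nat \<lfloor>H s\<rfloor>"] by blast
    have nat_H: "H t = real (nat \<lfloor>H t\<rfloor>)" for t
      by (cases t) (simp add: H_def qheight_def)
    have "H t' \<le> H s" if "s \<noteq> Z" "V s < V t" for s
      using t'(2)[of s] that nat_H[of s] nat_H[of t'] by simp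
    thus ?thesis using t'(1) unfolding step_def by blast
  qed
  moreover have "\<exists>t. t \<noteq> Z" by (rule exI[of _ "(1, 0, 0)"]) (simp add: Z_def)
  ultimately obtain f where f: "\<And>n. f n \<noteq> Z" "\<And>n. step (f n) (f (Suc n))"
    using dependent_nat_choice[of "\<lambda>_ t. t \<noteq> Z" "\<lambda>_. step"] by blast
  have V_dec: "V (f (Suc n)) < V (f n)" for n using f(2)[of n] by (simp add: step_def)
  have H_least: "H (f (Suc n)) \<le> H s" if "s \<noteq> Z" "V s < V (f n)" for n s
    using f(2)[of n] that unfolding step_def by blast
  have H_mono: "H (f (Suc n)) \<le> H (f (Suc (Suc n)))" for n
    using V_dec[of n] V_dec[of "Suc n"] by (intro H_least f) simp
  have "strict_mono (\<lambda>n. - V (f n))" by (rule strict_mono_Suc_iff[THEN iffD2]) (simp add: V_dec)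
  hence "inj f" by (metis (mono_tags, lifting) inj_def strict_mono_eq)
  have H_top: "filterlim (\<lambda>n. H (f n)) at_top sequentially"
    unfolding filterlim_at_top
  proof
    fix B
    have "finite (f -` {t. H t \<le> B})"
      using finite_qheight_le[of B] \<open>inj f\<close> by (intro finite_vimageI) (simp_all add: H_def case_prod_unfold)
    hence "\<forall>\<^sub>F n in sequentially. \<not> H (f n) \<le> B"
      by (simp add: cofinite_eq_sequentially[symmetric] eventually_cofinite vimage_def)
    thus "\<forall>\<^sub>F n in sequentially. B \<le> H (f n)" by eventually_elim simp
  qed
  have V_le: "V (f n) \<le> 1/4 * H (f (Suc n)) powr (- (golden\<^sup>2))"
    if large: "H (f (Suc n)) > max 1 B0" for n
  proof (rule tendsto_lowerbound)
    \<comment> \<open>For \<open>B\<close> below the next height, a triple of height at most \<open>B\<close> cannot beat \<open>f n\<close>, so the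
      approximation available at \<open>B\<close> already bounds the value of \<open>f n\<close>; then \<open>B\<close> tends to that height.\<close>
    let ?h = "H (f (Suc n))"
    show "((\<lambda>B. 1/4 * B powr (- (golden\<^sup>2))) \<longlongrightarrow> 1/4 * ?h powr (- (golden\<^sup>2))) (at_left ?h)"
      using large by (intro tendsto_intros) auto
    show "\<forall>\<^sub>F B in at_left ?h. V (f n) \<le> 1/4 * B powr (- (golden\<^sup>2))"
      using eventually_at_left_real[OF large]
    proof eventually_elim
      case (elim B)
      then obtain t where t: "t \<noteq> Z" "H t \<le> B" "V t \<le> 1/4 * B powr (- (golden\<^sup>2))"
        using B0[of B] by auto
      have "\<not> V t < V (f n)" using H_least[OF t(1), of n] t(2) elim by auto
      thus ?case using t(3) by linarith
    qed
  qed simp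
  \<comment> \<open>The sequence is shifted beyond \<open>N\<close>, where the approximations exist, and by one more
    step because the height of the arbitrary first triple need not be minimal.\<close>
  obtain N where N: "\<And>n. n \<ge> N \<Longrightarrow> H (f n) > max 1 B0"
    using H_top unfolding filterlim_at_top_dense eventually_sequentially by blast
  define a b c where "a n = fst (f (Suc (n + N)))" and "b n = fst (snd (f (Suc (n + N))))"
    and "c n = snd (snd (f (Suc (n + N))))" for n
  have VH: "cmod (qval \<xi> (a n) (b n) (c n)) = V (f (Suc (n + N)))"
    "qheight (a n) (b n) (c n) = H (f (Suc (n + N)))" for n
    by (simp_all add: a_def b_def c_def V_def H_def case_prod_unfold)
  have "minimal_sequence \<xi> a b c"
  proof (unfold_locales, unfold VH)
    fix n
    show "V (f (Suc (Suc n + N))) < V (f (Suc (n + N)))" using V_dec by simp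
    show "H (f (Suc (n + N))) \<le> H (f (Suc (Suc n + N)))" using H_mono by simp
    show "V (f (Suc (n + N))) \<le> 1/4 * H (f (Suc (Suc n + N))) powr (- (golden\<^sup>2))"
      using V_le[of "Suc (n + N)"] N[of "Suc (Suc (n + N))"] by simp
    show "1 < H (f (Suc (n + N)))" using N[of "Suc (n + N)"] by simp
    show "filterlim (\<lambda>n. H (f (Suc (n + N)))) at_top sequentially"
      using filterlim_compose[OF H_top filterlim_subseq[of "\<lambda>n. Suc (n + N)"]]
      by (simp add: strict_mono_def)
  next
    fix p q :: int
    assume "of_int p + of_int q * \<xi> = 0"
    hence "qval \<xi> p q 0 = 0" by (simp add: qval_def)
    thus "q = 0" using no_relation by blast
  qed
  thus False using assms(1) by (rule minimal_sequence.no_sequence_in_unit_disc)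
qed

section \<open>The criterion\<close>

lemma coeff_le_poly_height: "\<bar>coeff P i\<bar> \<le> poly_height P"
proof (cases "i \<le> degree P")
  case True
  thus ?thesis unfolding poly_height_def by (intro Max_ge) auto
next
  case False
  have "0 \<le> \<bar>coeff P 0\<bar>" by simp
  also have "\<dots> \<le> poly_height P" unfolding poly_height_def by (intro Max_ge) auto
  finally show ?thesis using False by (simp add: coeff_eq_0)
qed

lemma quadratic_poly_eq:
  assumes "degree P \<le> 2"
  shows "P = [:coeff P 0, coeff P 1, coeff P 2:]"
proof (rule poly_eqI)
  fix n :: nat
  have "n = 0 \<or> n = 1 \<or> n = 2 \<or> n > 2" by linarith
  thus "coeff P n = coeff [:coeff P 0, coeff P 1, coeff P 2:] n"
    using assms by (auto simp: coeff_pCons numeral_2_eq_2 coeff_eq_0 split: nat.split)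
qed

lemma monic_irreducible_annihilator:
  assumes "q \<noteq> 0" and "poly (map_poly of_rat q) (x :: complex) = 0"
  shows "\<exists>p. lead_coeff p = 1 \<and> irreducible p \<and> poly (map_poly of_rat p) x = 0 \<and> degree p \<le> degree q"
  using assms
proof (induction "degree q" arbitrary: q rule: less_induct)
  case less
  show ?case
  proof (cases "irreducible q")
    case True
    let ?u = "inverse (lead_coeff q)"
    have "poly (map_poly of_rat (smult ?u q)) x = 0"
      using less.prems poly_of_rat_mult[of "[:?u:]" q x] by simp
    moreover have "[:?u:] dvd 1" using less.prems by (simp add: is_unit_iff_degree)
    hence "irreducible (smult ?u q)"
      using True irreducible_mult_unit_left[of "[:?u:]" q] by simp
    ultimately show ?thesis using less.prems by (intro exI[of _ "smult ?u q"]) auto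
  next
    case False
    have "\<not> q dvd 1"
    proof
      assume "q dvd 1"
      then obtain u where "q = [:u:]" by (auto simp: is_unit_poly_iff)
      thus False using less.prems by (simp add: map_poly_pCons)
    qed
    then obtain g h where gh: "q = g * h" "\<not> g dvd 1" "\<not> h dvd 1"
      using False less.prems by (auto simp: irreducible_def)
    have nz: "g \<noteq> 0" "h \<noteq> 0" using gh less.prems by auto
    hence deg: "degree q = degree g + degree h" "degree g > 0" "degree h > 0"
      using gh by (auto simp: degree_mult_eq is_unit_iff_degree)
    have "poly (map_poly of_rat g) x = 0 \<or> poly (map_poly of_rat h) x = 0"
      using less.prems gh by (simp add: poly_of_rat_mult)
    thus ?thesis
      using less.hyps[of g] less.hyps[of h] nz deg by force
  qed
qed

lemma algebraic_degree_le:
  fixes x :: complex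
  assumes "q \<noteq> 0" and "poly (map_poly of_int q) x = 0"
  shows "algebraic x \<and> algebraic_degree x \<le> degree q"
proof
  show alg: "algebraic x"
    unfolding algebraic_def
    by (rule exI[of _ "map_poly of_int q"]) (use assms in \<open>auto simp: coeff_map_poly map_poly_eq_0_iff\<close>)
  have "map_poly of_rat (map_poly of_int q) = (map_poly of_int q :: complex poly)"
    by (rule poly_eqI) (simp add: coeff_map_poly)
  hence "\<exists>p. lead_coeff p = 1 \<and> irreducible p \<and> poly (map_poly of_rat p) x = 0
      \<and> degree p \<le> degree (map_poly of_int q :: rat poly)"
    using assms by (intro monic_irreducible_annihilator) (auto simp: map_poly_eq_0_iff)
  then obtain p where p: "lead_coeff p = 1 \<and> irreducible p \<and> poly (map_poly of_rat p) x = 0"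
    "degree p \<le> degree (map_poly of_int q :: rat poly)" by blast
  have "min_poly_rat x = p"
    unfolding min_poly_rat_def by (rule the1_equality[OF min_poly_rat_unique_exists[OF alg] p(1)])
  thus "algebraic_degree x \<le> degree q"
    using p(2) by (simp add: algebraic_degree_def degree_map_poly)
qed

theorem mainTheorem1:
  fixes \<xi> :: complex and \<gamma> :: real
  assumes gamma: "\<gamma> = (1 + sqrt 5) / 2"
    and approx: "\<forall>\<^sub>F X :: real in at_top.
      \<exists>P :: int poly. P \<noteq> 0 \<and> degree P \<le> 2 \<and> real_of_int (poly_height P) \<le> X \<and>
        cmod (poly (map_poly of_int P) \<xi>) \<le> 1 / 4 * X powr (- (\<gamma>\<^sup>2))"
  shows "algebraic \<xi> \<and> algebraic_degree \<xi> \<le> 2"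
proof -
  have poly_qval: "poly (map_poly of_int [:p, q, r:]) \<xi> = qval \<xi> p q r" for p q r
    by (simp add: qval_def map_poly_pCons power2_eq_square algebra_simps)
  have approx': "\<forall>\<^sub>F B in at_top. \<exists>p q r. (p, q, r) \<noteq> (0, 0, 0) \<and> qheight p q r \<le> B \<and>
        cmod (qval \<xi> p q r) \<le> 1/4 * B powr (- (golden\<^sup>2))"
    using approx
  proof eventually_elim
    case (elim B)
    then obtain P where P: "P \<noteq> 0" "degree P \<le> 2" "real_of_int (poly_height P) \<le> B"
      "cmod (poly (map_poly of_int P) \<xi>) \<le> 1/4 * B powr (- (golden\<^sup>2))"
      unfolding gamma golden_def by blast
    let ?p = "coeff P 0" and ?q = "coeff P 1" and ?r = "coeff P 2"
    note P_eq = quadratic_poly_eq[OF P(2)]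
    have "(?p, ?q, ?r) \<noteq> (0, 0, 0)" using P(1) P_eq by auto
    moreover have "qheight ?p ?q ?r \<le> B"
      using P(3) coeff_le_poly_height[of P 0] coeff_le_poly_height[of P 1]
        coeff_le_poly_height[of P 2] unfolding qheight_def by linarith
    moreover have "cmod (qval \<xi> ?p ?q ?r) \<le> 1/4 * B powr (- (golden\<^sup>2))"
      using P(4) poly_qval[of ?p ?q ?r] P_eq by simp
    ultimately show ?case by blast
  qed
  have "\<exists>p q r. (p, q, r) \<noteq> (0, 0, 0) \<and> qval \<xi> p q r = 0"
  proof (cases "cmod \<xi> \<le> 1")
    case True
    thus ?thesis using approx' by (rule integral_quadratic_relation)
  next
    case False
    hence \<xi>: "\<xi> \<noteq> 0" "1 \<le> cmod \<xi>" by auto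
    \<comment> \<open>Passing to reciprocal polynomials preserves heights and does not increase values.\<close>
    have reverse: "qval \<xi> p q r = \<xi>\<^sup>2 * qval (inverse \<xi>) r q p" for p q r
      using \<xi> by (simp add: qval_def power2_eq_square field_simps)
    have "cmod (qval (inverse \<xi>) r q p) \<le> cmod (qval \<xi> p q r)" for p q r
      unfolding reverse norm_mult norm_power
      using mult_right_mono[of 1 "(cmod \<xi>)\<^sup>2" "cmod (qval (inverse \<xi>) r q p)"] \<xi>(2) by simp
    moreover have "qheight r q p = qheight p q r" for p q r
      by (simp add: qheight_def max.commute max.left_commute)
    ultimately have "\<forall>\<^sub>F B in at_top. \<exists>p q r. (p, q, r) \<noteq> (0, 0, 0) \<and> qheight p q r \<le> B \<and>
        cmod (qval (inverse \<xi>) p q r) \<le> 1/4 * B powr (- (golden\<^sup>2))"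
      using approx' by (elim eventually_mono) (metis (no_types, lifting) Pair_inject order.trans)
    moreover have "cmod (inverse \<xi>) \<le> 1" using \<xi> by (simp add: norm_inverse inverse_le_1_iff)
    ultimately obtain p q r where "(p, q, r) \<noteq> (0, 0, 0)" "qval (inverse \<xi>) p q r = 0"
      using integral_quadratic_relation by blast
    thus ?thesis using reverse[of r q p] by (intro exI[of _ r] exI[of _ q] exI[of _ p]) auto
  qed
  then obtain p q r where pqr: "(p, q, r) \<noteq> (0, 0, 0)" "qval \<xi> p q r = 0" by blast
  have "degree [:p, q, r:] \<le> 2" by (simp add: degree_pCons_le)
  moreover have "algebraic \<xi> \<and> algebraic_degree \<xi> \<le> degree [:p, q, r:]"
    using pqr poly_qval[of p q r] by (intro algebraic_degree_le) auto
  ultimately show ?thesis by linarith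
qed

end
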